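(* Let $X_0\xrightarrow{\varphi}X_1\xleftarrow{\pi}Y\times X_0$ be a fully injective similarity scheme. Then $\mathcal R_\infty$ is a closed equivalence relation on $Y^{\mathbb N}$ (i.e. its graph is closed in $Y^{\mathbb N}\times Y^{\mathbb N}$); namely, the space $X_\infty=Y^{\mathbb N}/\mathcal R_\infty$ endowed with the quotient topology is compact Hausdorff.
   Context: Similarity scheme. A similarity scheme $X_0\xrightarrow{\varphi}X_1\xleftarrow{\pi}Y\times X_0$ consists of compact Hausdorff spaces $X_0,X_1,Y$, a continuous injective map $\varphi:X_0\to X_1$ and a continuous surjective map $\pi:Y\times X_0\to X_1$. Tower. Put $\varphi_{1,0}=\varphi$, $\pi_{1,0}=\pi$. Inductively, for $n\ge1$, let $X_{n+1}=(Y\times X_n)/\sim$ (quotient topology; it is compact Hausdorff), where $(y,z)\sim(y',z')$ iff either $(y,z)=(y',z')$ or there are $x_0,x_0'\in X_0$ with $z=\varphi_{n,0}(x_0)$, $z'=\varphi_{n,0}(x_0')$, $\pi(y,x_0)=\pi(y',x_0')$; let $\pi_{1,n}:Y\times X_n\to X_{n+1}$ be the quotient map, and let $\varphi_{n+1,n}:X_n\to X_{n+1}$ be the (well-defined, continuous, injective) map with $\varphi_{n+1,n}(\pi_{1,n-1}(y,x))=\pi_{1,n}(y,\varphi_{n,n-1}(x))$. For $n\ge m$, $\varphi_{n,m}:X_m\to X_n$ is the composite $\varphi_{n,n-1}\circ\cdots\circ\varphi_{m+1,m}$ ($\varphi_{n,n}=\mathrm{id}$). Define $\pi_{p,q}:Y^p\times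 X_q\to X_{p+q}$ by $\pi_{0,q}=\mathrm{id}$ and $\pi_{p,q}=\pi_{p-1,q+1}\circ(\mathrm{id}_{Y^{p-1}}\times\pi_{1,q})$ for $p\ge1$. Limit space. For $(y_1,\dots,y_p)\in Y^p$ the cell is $C(y_1,\dots,y_p)=\{\pi_{p,0}(y_1,\dots,y_p,x):x\in X_0\}\subset X_p$ (for $p=0$ it is $X_0$). $Y^{\mathbb N}$ is the space of sequences $(y_1,y_2,\dots)$ in $Y$ with the product topology. For $x_n\in X_n$, $\Gamma_n(x_n)=\{(y_1,y_2,\dots)\in Y^{\mathbb N}:\varphi_{p,n}(x_n)\in C(y_1,\dots,y_p)\ \forall p\ge n\}$ (a nonempty closed set). The relation $\mathcal R$ on $Y^{\mathbb N}$: $u\,\mathcal R\,v$ iff $u=v$ or there are $n\ge0$ and $x_n\in X_n$ with $u,v\in\Gamma_n(x_n)$. $\mathcal R_\infty$ is the smallest equivalence relation containing $\mathcal R$; $\pi^{\mathbb N}:Y^{\mathbb N}\to X_\infty$ is the quotient map. $\varphi_{\infty,n}:X_n\to X_\infty$ sends $x_n$ to the unique element of $\pi^{\mathbb N}(\Gamma_n(x_n))$. The scheme is fully injective if all maps $\varphi_{\infty,n}$, $n\ge0$, are injective. *)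

theory Defs
  imports "HOL-Analysis.Analysis"
begin

definition quotient_topology :: "'a topology \<Rightarrow> ('a \<Rightarrow> 'b) \<Rightarrow> 'b topology" where
  "quotient_topology X q =
     topology (\<lambda>U. U \<subseteq> q ` topspace X \<and> openin X {x \<in> topspace X. q x \<in> U})"

lemma openin_quotient_topology:
  "openin (quotient_topology X q) U \<longleftrightarrow>
     U \<subseteq> q ` topspace X \<and> openin X {x \<in> topspace X. q x \<in> U}"
proof -
  have *: "{x \<in> topspace X. q x \<in> S \<inter> T} =
      {x \<in> topspace X. q x \<in> S} \<inter> {x \<in> topspace X. q x \<in> T}" for S T
    by auto
  have **: "{x \<in> topspace X. q x \<in> \<Union>K} = (\<Union>U\<in>K. {x \<in> topspace X. q x \<in> U})" for K
    by auto
  have "istopology (\<lambda>U. U \<subseteq> q ` topspace X \<and> openin X {x \<in> topspace X. q x \<in> U})"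
    unfolding istopology_def * ** by blast
  then show ?thesis
    by (simp add: quotient_topology_def topology_inverse')
qed

lemma topspace_quotient_topology [simp]:
  "topspace (quotient_topology X q) = q ` topspace X"
proof (rule antisym)
  show "topspace (quotient_topology X q) \<subseteq> q ` topspace X"
    using openin_quotient_topology[of X q] openin_topspace by blast
  have "{x \<in> topspace X. q x \<in> q ` topspace X} = topspace X"
    by auto
  then have "openin (quotient_topology X q) (q ` topspace X)"
    by (simp add: openin_quotient_topology)
  then show "q ` topspace X \<subseteq> topspace (quotient_topology X q)"
    by (rule openin_subset)
qed

lemma quotient_map_quotient_topology: "quotient_map X (quotient_topology X q) q"
  by (auto simp: quotient_map_def openin_quotient_topology)


record ('a, 'b, 'y) scheme =
  sX0 :: "'a topology"
  sX1 :: "'b topology"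
  sY :: "'y topology"
  sphi :: "'a \<Rightarrow> 'b"
  spi :: "'y \<times> 'a \<Rightarrow> 'b"

definition similarity_scheme :: "('a, 'b, 'y) scheme \<Rightarrow> bool" where
  "similarity_scheme S \<longleftrightarrow>
     compact_space (sX0 S) \<and> Hausdorff_space (sX0 S) \<and>
     compact_space (sX1 S) \<and> Hausdorff_space (sX1 S) \<and>
     compact_space (sY S) \<and> Hausdorff_space (sY S) \<and>
     continuous_map (sX0 S) (sX1 S) (sphi S) \<and>
     inj_on (sphi S) (topspace (sX0 S)) \<and>
     continuous_map (prod_topology (sY S) (sX0 S)) (sX1 S) (spi S) \<and>
     spi S ` (topspace (sY S) \<times> topspace (sX0 S)) = topspace (sX1 S)"

text \<open>
  The spaces of the tower must all live on one type.  \<open>P0\<close> and \<open>P1\<close> embed the given spaces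
  $X_0$ and $X_1$; for $n \ge 1$ a point of $X_{n+1} = (Y \times X_n)/{\sim}$, i.e. an equivalence
  class of pairs, is named by one chosen member \<open>(y, z)\<close> of that class, written \<open>Cls y z\<close>.
  The carrier of $X_{n+1}$ thus has exactly one point for each class (see \<open>tower_pi_eq_iff\<close> below)
  and carries the quotient topology.
\<close>

datatype ('a, 'b, 'y) point = P0 (un_P0: 'a) | P1 'b | Cls 'y "('a, 'b, 'y) point"

definition choose_class :: "('p \<times> 'p) set \<Rightarrow> 'p \<Rightarrow> 'p" where
  "choose_class E p = (SOME q. q \<in> E `` {p})"

definition glue_rel ::
    "('a, 'b, 'y) scheme \<Rightarrow> 'z set \<Rightarrow> ('a \<Rightarrow> 'z) \<Rightarrow> (('y \<times> 'z) \<times> ('y \<times> 'z)) set" where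
  "glue_rel S Z f =
     {((y, z), (y', z')). y \<in> topspace (sY S) \<and> z \<in> Z \<and> y' \<in> topspace (sY S) \<and> z' \<in> Z \<and>
        ((y, z) = (y', z') \<or>
         (\<exists>x \<in> topspace (sX0 S). \<exists>x' \<in> topspace (sX0 S).
            z = f x \<and> z' = f x' \<and> spi S (y, x) = spi S (y', x')))}"

text \<open>
  \<open>tower S n\<close> is $X_n$, \<open>tower_pi S n\<close> is $\pi_{1,n}$, \<open>tower_step S n\<close> is $\varphi_{n+1,n}$ and
  \<open>tower_phi S n m\<close> is $\varphi_{n,m}$ for $n \ge m$ (the identity, as a junk value, for $n < m$).
\<close>

function (sequential)
  tower :: "('a, 'b, 'y) scheme \<Rightarrow> nat \<Rightarrow> ('a, 'b, 'y) point topology" and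
  tower_pi :: "('a, 'b, 'y) scheme \<Rightarrow> nat \<Rightarrow> 'y \<times> ('a, 'b, 'y) point \<Rightarrow> ('a, 'b, 'y) point" and
  tower_step :: "('a, 'b, 'y) scheme \<Rightarrow> nat \<Rightarrow> ('a, 'b, 'y) point \<Rightarrow> ('a, 'b, 'y) point" and
  tower_phi :: "('a, 'b, 'y) scheme \<Rightarrow> nat \<Rightarrow> nat \<Rightarrow> ('a, 'b, 'y) point \<Rightarrow> ('a, 'b, 'y) point"
where
  "tower S 0 = quotient_topology (sX0 S) P0"
| "tower S (Suc 0) = quotient_topology (sX1 S) P1"
| "tower S (Suc (Suc n)) =
     quotient_topology (prod_topology (sY S) (tower S (Suc n))) (tower_pi S (Suc n))"
| "tower_pi S 0 = (\<lambda>(y, z). P1 (spi S (y, un_P0 z)))"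
| "tower_pi S (Suc n) = (\<lambda>p. case_prod Cls (choose_class
     (glue_rel S (topspace (tower S (Suc n))) (\<lambda>x. tower_phi S (Suc n) 0 (P0 x))) p))"
| "tower_step S 0 = (\<lambda>z. P1 (sphi S (un_P0 z)))"
| "tower_step S (Suc n) = (\<lambda>w. THE v. \<exists>y \<in> topspace (sY S). \<exists>x \<in> topspace (tower S n).
     w = tower_pi S n (y, x) \<and> v = tower_pi S (Suc n) (y, tower_step S n x))"
| "tower_phi S 0 m = id"
| "tower_phi S (Suc n) m = (if n < m then id else tower_step S n \<circ> tower_phi S n m)"
  by pat_completeness auto
termination
  by (relation "Wellfounded.measure (case_sum (case_sum (\<lambda>(S, n). 4 * n + 1) (\<lambda>(S, n). 4 * n + 2))
       (case_sum (\<lambda>(S, n). 4 * n + 3) (\<lambda>(S, n, m). 4 * n)))") auto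

text \<open>
  \<open>tower_pi_iter S p q y\<close> is $\pi_{p,q}(y_1,\dots,y_p,\cdot)$.  Sequences are indexed from 0, so
  $y_i$ is \<open>y (i - 1)\<close>, and an element of $Y^p$ is given as the first \<open>p\<close> entries of a sequence.
\<close>

fun tower_pi_iter ::
    "('a, 'b, 'y) scheme \<Rightarrow> nat \<Rightarrow> nat \<Rightarrow> (nat \<Rightarrow> 'y) \<Rightarrow> ('a, 'b, 'y) point \<Rightarrow> ('a, 'b, 'y) point" where
  "tower_pi_iter S 0 q y x = x"
| "tower_pi_iter S (Suc p) q y x = tower_pi_iter S p (Suc q) y (tower_pi S q (y p, x))"

definition cell :: "('a, 'b, 'y) scheme \<Rightarrow> nat \<Rightarrow> (nat \<Rightarrow> 'y) \<Rightarrow> ('a, 'b, 'y) point set" where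
  "cell S p y = tower_pi_iter S p 0 y ` topspace (tower S 0)"

definition seq_space :: "('a, 'b, 'y) scheme \<Rightarrow> (nat \<Rightarrow> 'y) topology" where
  "seq_space S = product_topology (\<lambda>_. sY S) UNIV"

definition Gam :: "('a, 'b, 'y) scheme \<Rightarrow> nat \<Rightarrow> ('a, 'b, 'y) point \<Rightarrow> (nat \<Rightarrow> 'y) set" where
  "Gam S n x = {u \<in> topspace (seq_space S). \<forall>p \<ge> n. tower_phi S p n x \<in> cell S p u}"

definition rel_R :: "('a, 'b, 'y) scheme \<Rightarrow> ((nat \<Rightarrow> 'y) \<times> (nat \<Rightarrow> 'y)) set" where
  "rel_R S = {(u, v). u \<in> topspace (seq_space S) \<and> v \<in> topspace (seq_space S) \<and>
     (u = v \<or> (\<exists>n. \<exists>x \<in> topspace (tower S n). u \<in> Gam S n x \<and> v \<in> Gam S n x))}"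

definition rel_R_inf :: "('a, 'b, 'y) scheme \<Rightarrow> ((nat \<Rightarrow> 'y) \<times> (nat \<Rightarrow> 'y)) set" where
  "rel_R_inf S = \<Inter>{E. equiv (topspace (seq_space S)) E \<and> rel_R S \<subseteq> E}"

definition pi_inf :: "('a, 'b, 'y) scheme \<Rightarrow> (nat \<Rightarrow> 'y) \<Rightarrow> (nat \<Rightarrow> 'y) set" where
  "pi_inf S u = rel_R_inf S `` {u}"

definition limit_space :: "('a, 'b, 'y) scheme \<Rightarrow> (nat \<Rightarrow> 'y) set topology" where
  "limit_space S = quotient_topology (seq_space S) (pi_inf S)"

definition phi_inf :: "('a, 'b, 'y) scheme \<Rightarrow> nat \<Rightarrow> ('a, 'b, 'y) point \<Rightarrow> (nat \<Rightarrow> 'y) set" where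
  "phi_inf S n x = (THE c. c \<in> pi_inf S ` Gam S n x)"

definition fully_injective :: "('a, 'b, 'y) scheme \<Rightarrow> bool" where
  "fully_injective S \<longleftrightarrow> (\<forall>n. inj_on (phi_inf S n) (topspace (tower S n)))"


lemma topspace_limit_space: "topspace (limit_space S) = topspace (seq_space S) // rel_R_inf S"
  by (auto simp: limit_space_def pi_inf_def quotient_def)

lemma equiv_glue_rel:
  assumes "inj_on f (topspace (sX0 S))"
  shows "equiv (topspace (sY S) \<times> Z) (glue_rel S Z f)"
proof (rule equivI)
  show "glue_rel S Z f \<subseteq> (topspace (sY S) \<times> Z) \<times> topspace (sY S) \<times> Z"
    by (auto simp: glue_rel_def)
  show "refl_on (topspace (sY S) \<times> Z) (glue_rel S Z f)"
    by (auto simp: glue_rel_def refl_on_def)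
  show "sym (glue_rel S Z f)"
    by (fastforce simp: glue_rel_def sym_def)
  show "trans (glue_rel S Z f)"
  proof (rule transI)
    fix p q r assume pq: "(p, q) \<in> glue_rel S Z f" and qr: "(q, r) \<in> glue_rel S Z f"
    show "(p, r) \<in> glue_rel S Z f"
    proof (cases "p = q \<or> q = r")
      case False
      obtain x x' where x: "x \<in> topspace (sX0 S)" "x' \<in> topspace (sX0 S)"
        "snd p = f x" "snd q = f x'" "spi S (fst p, x) = spi S (fst q, x')"
        using pq False by (cases p; cases q) (auto simp: glue_rel_def)
      obtain z z' where z: "z \<in> topspace (sX0 S)" "z' \<in> topspace (sX0 S)"
        "snd q = f z" "snd r = f z'" "spi S (fst q, z) = spi S (fst r, z')"
        using qr False by (cases q; cases r) (auto simp: glue_rel_def)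
      have "x' = z"
        using assms x z by (auto dest: inj_onD)
      then have "spi S (fst p, x) = spi S (fst r, z')"
        using x z by simp
      moreover have "fst p \<in> topspace (sY S)" "snd p \<in> Z" "fst r \<in> topspace (sY S)" "snd r \<in> Z"
        using pq qr by (auto simp: glue_rel_def)
      ultimately have "((fst p, snd p), (fst r, snd r)) \<in> glue_rel S Z f"
        unfolding glue_rel_def using x(1,3) z(2,4) by blast
      then show ?thesis
        by simp
    qed (use pq qr in auto)
  qed
qed

lemma choose_class_eq_iff:
  assumes E: "equiv A E" and "p \<in> A" "q \<in> A"
  shows "choose_class E p = choose_class E q \<longleftrightarrow> (p, q) \<in> E"
proof
  have *: "(r, choose_class E r) \<in> E" if "r \<in> A" for r
  proof -
    have "r \<in> E `` {r}"
      using E that by (rule equiv_class_self)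
    then show ?thesis
      unfolding choose_class_def by (metis (no_types, lifting) Image_singleton_iff someI)
  qed
  assume "choose_class E p = choose_class E q"
  then have "(p, choose_class E q) \<in> E" "(choose_class E q, q) \<in> E"
    using *[of p] *[of q] assms by (auto simp: equiv_def dest: symD)
  then show "(p, q) \<in> E"
    using E by (auto simp: equiv_def dest: transD)
next
  assume "(p, q) \<in> E"
  then show "choose_class E p = choose_class E q"
    using E by (simp add: choose_class_def equiv_class_eq)
qed

lemma quotient_map_tower_Suc:
  "quotient_map (prod_topology (sY S) (tower S (Suc n))) (tower S (Suc (Suc n))) (tower_pi S (Suc n))"
  by (simp add: quotient_map_quotient_topology del: tower_pi.simps)

lemma tower_pi_image:
  assumes "similarity_scheme S"
  shows "tower_pi S n ` (topspace (sY S) \<times> topspace (tower S n)) = topspace (tower S (Suc n))"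
proof (cases n)
  case 0
  have "tower_pi S 0 ` (topspace (sY S) \<times> P0 ` topspace (sX0 S)) =
      P1 ` spi S ` (topspace (sY S) \<times> topspace (sX0 S))"
    by (force simp: image_iff)
  then show ?thesis
    using assms 0 by (simp add: similarity_scheme_def del: tower_pi.simps)
qed (simp del: tower_pi.simps)

lemma tower_pi_eq_iff_aux:
  assumes "inj_on (\<lambda>x. tower_phi S n 0 (P0 x)) (topspace (sX0 S))"
    and "p \<in> topspace (sY S) \<times> topspace (tower S n)"
    and "q \<in> topspace (sY S) \<times> topspace (tower S n)"
  shows "tower_pi S n p = tower_pi S n q \<longleftrightarrow>
     (p, q) \<in> glue_rel S (topspace (tower S n)) (\<lambda>x. tower_phi S n 0 (P0 x))"
proof (cases n)
  case 0
  then show ?thesis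
    using assms(2,3) by (auto simp: glue_rel_def)
next
  case (Suc k)
  then show ?thesis
    using choose_class_eq_iff[OF equiv_glue_rel[OF assms(1)] assms(2,3)]
    by (auto split: prod.splits simp del: tower.simps tower_phi.simps)
qed

lemma glue_rel_shift:
  assumes "inj_on g Z" "f ` topspace (sX0 S) \<subseteq> Z" "g ` Z \<subseteq> Z'" "z \<in> Z" "z' \<in> Z"
  shows "((y, g z), (y', g z')) \<in> glue_rel S Z' (\<lambda>x. g (f x)) \<longleftrightarrow>
     ((y, z), (y', z')) \<in> glue_rel S Z f"
proof -
  have *: "g z = g w \<longleftrightarrow> z = w" if "z \<in> Z" "w \<in> Z" for z w
    using assms(1) that by (auto dest: inj_onD)
  have "f x \<in> Z" if "x \<in> topspace (sX0 S)" for x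
    using assms(2) that by auto
  then have "z = f x \<longleftrightarrow> g z = g (f x)" "z' = f x \<longleftrightarrow> g z' = g (f x)"
    if "x \<in> topspace (sX0 S)" for x
    using that * assms(4,5) by blast+
  moreover have "g z \<in> Z'" "g z' \<in> Z'"
    using assms by auto
  ultimately show ?thesis
    using assms(4,5) *[of z z'] unfolding glue_rel_def by auto
qed

lemma tower_phi_Suc_0: "tower_phi S (Suc n) 0 z = tower_step S n (tower_phi S n 0 z)"
  by simp

lemma tower_invariant:
  assumes S: "similarity_scheme S"
  shows "inj_on (\<lambda>x. tower_phi S n 0 (P0 x)) (topspace (sX0 S)) \<and>
    (\<lambda>x. tower_phi S n 0 (P0 x)) ` topspace (sX0 S) \<subseteq> topspace (tower S n) \<and>
    inj_on (tower_step S n) (topspace (tower S n)) \<and>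
    tower_step S n ` topspace (tower S n) \<subseteq> topspace (tower S (Suc n)) \<and>
    (\<forall>y \<in> topspace (sY S). \<forall>x \<in> topspace (tower S n).
       tower_step S (Suc n) (tower_pi S n (y, x)) = tower_pi S (Suc n) (y, tower_step S n x))"
    (is "?I n \<and> ?J n \<and> ?K n \<and> ?L n \<and> ?M n")
proof -
  have next_I: "?I (Suc n) \<and> ?J (Suc n)" if "?I n" "?J n" "?K n" "?L n" for n
  proof
    show "?I (Suc n)"
      unfolding tower_phi_Suc_0 using comp_inj_on[OF that(1) inj_on_subset[OF that(3,2)]]
      by (simp add: o_def del: tower.simps tower_phi.simps tower_step.simps)
    show "?J (Suc n)"
      unfolding tower_phi_Suc_0 using that by blast
  qed
  have kernel: "tower_pi S (Suc n) (y, tower_step S n x) = tower_pi S (Suc n) (y', tower_step S n x')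
      \<longleftrightarrow> tower_pi S n (y, x) = tower_pi S n (y', x')"
    if IJKL: "?I n" "?J n" "?K n" "?L n" and yx: "y \<in> topspace (sY S)" "y' \<in> topspace (sY S)"
      "x \<in> topspace (tower S n)" "x' \<in> topspace (tower S n)" for n y y' x x'
  proof -
    have "tower_step S n x \<in> topspace (tower S (Suc n))" "tower_step S n x' \<in> topspace (tower S (Suc n))"
      using IJKL yx by blast+
    then have "tower_pi S (Suc n) (y, tower_step S n x) = tower_pi S (Suc n) (y', tower_step S n x') \<longleftrightarrow>
      ((y, tower_step S n x), (y', tower_step S n x')) \<in> glue_rel S (topspace (tower S (Suc n)))
         (\<lambda>x. tower_phi S (Suc n) 0 (P0 x))"
      using yx next_I[OF IJKL] by (intro tower_pi_eq_iff_aux) blast+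
    also have "\<dots> \<longleftrightarrow> ((y, x), (y', x')) \<in> glue_rel S (topspace (tower S n)) (\<lambda>x. tower_phi S n 0 (P0 x))"
      unfolding tower_phi_Suc_0 by (rule glue_rel_shift) (use IJKL yx in blast)+
    also have "\<dots> \<longleftrightarrow> tower_pi S n (y, x) = tower_pi S n (y', x')"
      by (rule tower_pi_eq_iff_aux[symmetric]) (use IJKL yx in blast)+
    finally show ?thesis .
  qed
  have next_M: "?M n" if IJKL: "?I n" "?J n" "?K n" "?L n" for n
  proof (intro ballI)
    fix y x assume yx: "y \<in> topspace (sY S)" "x \<in> topspace (tower S n)"
    show "tower_step S (Suc n) (tower_pi S n (y, x)) = tower_pi S (Suc n) (y, tower_step S n x)"
      unfolding tower_step.simps(2)[of S n]
    proof (rule the_equality)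
      show "\<exists>ya\<in>topspace (sY S). \<exists>xa\<in>topspace (tower S n). tower_pi S n (y, x) = tower_pi S n (ya, xa) \<and>
          tower_pi S (Suc n) (y, tower_step S n x) = tower_pi S (Suc n) (ya, tower_step S n xa)"
        using yx by blast
    next
      fix v assume "\<exists>ya\<in>topspace (sY S). \<exists>xa\<in>topspace (tower S n).
        tower_pi S n (y, x) = tower_pi S n (ya, xa) \<and> v = tower_pi S (Suc n) (ya, tower_step S n xa)"
      then obtain y' x' where *: "y' \<in> topspace (sY S)" "x' \<in> topspace (tower S n)"
        "tower_pi S n (y, x) = tower_pi S n (y', x')"
        "v = tower_pi S (Suc n) (y', tower_step S n x')"
        by blast
      show "v = tower_pi S (Suc n) (y, tower_step S n x)"
        by (rule trans[OF *(4) sym[OF kernel[OF IJKL yx(1) *(1) yx(2) *(2), THEN iffD2, OF *(3)]]])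
    qed
  qed
  have IJKL: "?I n \<and> ?J n \<and> ?K n \<and> ?L n" for n
  proof (induction n)
    case 0
    have "inj_on (sphi S) (topspace (sX0 S))" "sphi S ` topspace (sX0 S) \<subseteq> topspace (sX1 S)"
      using S by (auto simp: similarity_scheme_def continuous_map_def)
    then show ?case
      by (auto simp: inj_on_def)
  next
    case (Suc n)
    then have H: "?I n" "?J n" "?K n" "?L n"
      by blast+
    note M = next_M[OF H] and ker = kernel[OF H] and img = tower_pi_image[OF S, of n]
    have "?K (Suc n)"
    proof (rule inj_onI)
      fix w w' assume w: "w \<in> topspace (tower S (Suc n))" "w' \<in> topspace (tower S (Suc n))"
        and eq: "tower_step S (Suc n) w = tower_step S (Suc n) w'"
      obtain y x where 1: "y \<in> topspace (sY S)" "x \<in> topspace (tower S n)" "w = tower_pi S n (y, x)"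
        using w img by blast
      obtain y' x' where 2: "y' \<in> topspace (sY S)" "x' \<in> topspace (tower S n)" "w' = tower_pi S n (y', x')"
        using w img by blast
      have "tower_pi S (Suc n) (y, tower_step S n x) = tower_pi S (Suc n) (y', tower_step S n x')"
        by (rule trans[OF sym[OF M[rule_format, OF 1(1,2)]]
             trans[OF eq[unfolded 1(3) 2(3)] M[rule_format, OF 2(1,2)]]])
      then show "w = w'"
        unfolding 1(3) 2(3) using ker[OF 1(1) 2(1) 1(2) 2(2)] by blast
    qed
    moreover have "?L (Suc n)"
    proof
      fix v assume "v \<in> tower_step S (Suc n) ` topspace (tower S (Suc n))"
      then obtain w where w: "w \<in> topspace (tower S (Suc n))" "v = tower_step S (Suc n) w"
        by (rule imageE)
      obtain y x where 1: "y \<in> topspace (sY S)" "x \<in> topspace (tower S n)" "w = tower_pi S n (y, x)"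
        using w(1) img by blast
      have "v = tower_pi S (Suc n) (y, tower_step S n x)"
        using M[rule_format, OF 1(1,2)] unfolding w(2) 1(3) .
      moreover have "tower_step S n x \<in> topspace (tower S (Suc n))"
        using H 1 by blast
      ultimately show "v \<in> topspace (tower S (Suc (Suc n)))"
        using tower_pi_image[OF S, of "Suc n"] 1 by blast
    qed
    ultimately show ?case
      using next_I[OF H] by blast
  qed
  show ?thesis
    using IJKL[of n] next_M[of n] by blast
qed

lemma tower_pi_eq_iff:
  assumes "similarity_scheme S"
    and "p \<in> topspace (sY S) \<times> topspace (tower S n)"
    and "q \<in> topspace (sY S) \<times> topspace (tower S n)"
  shows "tower_pi S n p = tower_pi S n q \<longleftrightarrow>
     (p, q) \<in> glue_rel S (topspace (tower S n)) (\<lambda>x. tower_phi S n 0 (P0 x))"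
  using tower_pi_eq_iff_aux tower_invariant assms by blast

lemma tower_step_pi:
  assumes "similarity_scheme S" "y \<in> topspace (sY S)" "x \<in> topspace (tower S n)"
  shows "tower_step S (Suc n) (tower_pi S n (y, x)) = tower_pi S (Suc n) (y, tower_step S n x)"
  using tower_invariant[OF assms(1), of n] assms(2,3) by blast

lemma inj_on_tower_step:
  assumes "similarity_scheme S"
  shows "inj_on (tower_step S n) (topspace (tower S n))"
  using tower_invariant[OF assms, of n] by blast

lemma equiv_rel_R_inf: "equiv (topspace (seq_space S)) (rel_R_inf S)"
proof -
  let ?A = "topspace (seq_space S)"
  let ?F = "{E. equiv ?A E \<and> rel_R S \<subseteq> E}"
  have "?A \<times> ?A \<in> ?F"
    by (auto simp: equiv_def refl_on_def sym_def trans_def rel_R_def)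
  then have "\<Inter>?F \<subseteq> ?A \<times> ?A"
    by blast
  moreover have "refl_on ?A (\<Inter>?F)"
    by (auto simp: equiv_def refl_on_def)
  moreover have "sym (\<Inter>?F)"
    by (rule symI) (auto simp: equiv_def dest: symD)
  moreover have "trans (\<Inter>?F)"
    by (rule transI) (auto simp: equiv_def dest: transD)
  ultimately show ?thesis
    unfolding rel_R_inf_def by (rule equivI)
qed

end

theory Submission
  imports Defs
begin

text \<open>
  Let $R_n$ consist of the pairs $(u, v)$ lying in a common $\Gamma_n(x)$ with $x \in X_n$. The $R_n$
  increase with $n$, and each is closed because the spaces $X_p$ are compact Hausdorff. Full
  injectivity makes the sets $\Gamma_n(x)$, $x \in X_n$, pairwise disjoint, so that
  $\mathcal R = \Delta \cup \bigcup_n R_n$ is already transitive and $\mathcal R_\infty = \mathcal R$.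
  By self-similarity a pair in $R_{n+1}$ either lies in $R_1$ or has equal first entries and shifts
  to a pair in $R_n$; hence a pair of $\mathcal R$ with $u_k \ne v_k$ lies in $R_k$ (counting entries
  from 1). Thus $\mathcal R = \bigcap_k (\{u_k = v_k\} \cup R_k)$ is closed, although an increasing
  union of closed sets need not be.
\<close>

section \<open>Quotients of compact Hausdorff spaces by closed relations\<close>

text \<open>Closedness of the kernel makes \<open>q\<close> a closed map: the saturation of a closed
  set \<open>C\<close> is the projection of the part of the kernel inside
  \<open>topspace X \<times> C\<close>, and projections along a compact factor are closed. Compact
  Hausdorff spaces are normal, and closed continuous images of normal Hausdorff spaces are
  Hausdorff.\<close>

lemma compact_Hausdorff_quotient_topology:
  assumes cpt: "compact_space X" and haus: "Hausdorff_space X"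
    and ker: "closedin (prod_topology X X)
      {(x, x'). x \<in> topspace X \<and> x' \<in> topspace X \<and> q x = q x'}"
  shows "compact_space (quotient_topology X q)" "Hausdorff_space (quotient_topology X q)"
proof -
  let ?Q = "quotient_topology X q"
  let ?K = "{(x, x'). x \<in> topspace X \<and> x' \<in> topspace X \<and> q x = q x'}"
  have quot: "quotient_map X ?Q q"
    by (rule quotient_map_quotient_topology)
  then have cont: "continuous_map X ?Q q"
    by (rule quotient_imp_continuous_map)
  have onto: "q ` topspace X = topspace ?Q"
    by simp
  show "compact_space ?Q"
    using image_compactin[OF cpt[unfolded compact_space_def] cont]
    by (simp add: compact_space_def)
  have "closed_map X ?Q q"
    unfolding closed_map_def
  proof (intro allI impI)
    fix C assume C: "closedin X C"
    have CX: "C \<subseteq> topspace X"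
      using C by (rule closedin_subset)
    have "closedin (prod_topology X X) (topspace X \<times> C)"
      using C by (simp add: closedin_prod_Times_iff)
    with ker have "closedin (prod_topology X X) (?K \<inter> topspace X \<times> C)"
      by (rule closedin_Int)
    then have "closedin X (fst ` (?K \<inter> topspace X \<times> C))"
      using Abstract_Topological_Spaces.closed_map_fst[OF cpt, of X] unfolding closed_map_def by blast
    also have "fst ` (?K \<inter> topspace X \<times> C) = {x \<in> topspace X. q x \<in> q ` C}"
    proof
      show "fst ` (?K \<inter> topspace X \<times> C) \<subseteq> {x \<in> topspace X. q x \<in> q ` C}"
        by auto
      show "{x \<in> topspace X. q x \<in> q ` C} \<subseteq> fst ` (?K \<inter> topspace X \<times> C)"
      proof
        fix x assume "x \<in> {x \<in> topspace X. q x \<in> q ` C}"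
        then obtain c where "x \<in> topspace X" "c \<in> C" "q x = q c"
          by blast
        then have "(x, c) \<in> ?K \<inter> topspace X \<times> C"
          using CX by auto
        then show "x \<in> fst ` (?K \<inter> topspace X \<times> C)"
          by (rule image_eqI[rotated]) simp
      qed
    qed
    finally have "closedin X {x \<in> topspace X. q x \<in> q ` C}" .
    moreover have "q ` C \<subseteq> topspace ?Q"
      using CX by auto
    ultimately show "closedin ?Q (q ` C)"
      using quot by (auto simp: quotient_map_closedin)
  qed
  with compact_Hausdorff_or_regular_imp_normal_space[OF cpt disjI1[OF haus]] haus
  show "Hausdorff_space ?Q"
    using cont onto by (rule normal_Hausdorff_space_closed_continuous_map_image[THEN conjunct2])
qed

section \<open>Algebra of the maps in the tower\<close>

context
  fixes S :: "('a, 'b, 'y) scheme"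
  assumes S: "similarity_scheme S"
begin

declare tower.simps [simp del] tower_pi.simps [simp del] tower_step.simps [simp del]
  tower_phi.simps [simp del]

lemma tower_phi_self [simp]: "tower_phi S n n = id"
  by (cases n) (auto simp: tower_phi.simps)

lemma tower_phi_Suc: "n \<le> p \<Longrightarrow> tower_phi S (Suc p) n x = tower_step S p (tower_phi S p n x)"
  by (simp add: tower_phi.simps)

lemma tower_phi_trans:
  assumes "n \<le> m" "m \<le> p"
  shows "tower_phi S p m (tower_phi S m n x) = tower_phi S p n x"
  using assms(2,1) by (induction p rule: dec_induct) (auto simp: tower_phi_Suc)

lemma tower_pi_in:
  "y \<in> topspace (sY S) \<Longrightarrow> x \<in> topspace (tower S n) \<Longrightarrow> tower_pi S n (y, x) \<in> topspace (tower S (Suc n))"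
  using tower_pi_image[OF S, of n] by blast

lemma tower_pi_cases:
  assumes "z \<in> topspace (tower S (Suc n))"
  obtains y x where "y \<in> topspace (sY S)" "x \<in> topspace (tower S n)" "z = tower_pi S n (y, x)"
  using assms tower_pi_image[OF S, of n] by blast

lemma tower_step_in: "x \<in> topspace (tower S n) \<Longrightarrow> tower_step S n x \<in> topspace (tower S (Suc n))"
  using tower_invariant[OF S, of n] by blast

lemma tower_phi_in:
  "n \<le> p \<Longrightarrow> x \<in> topspace (tower S n) \<Longrightarrow> tower_phi S p n x \<in> topspace (tower S p)"
  by (induction p rule: dec_induct) (auto simp: tower_phi_Suc tower_step_in)

lemma tower_phi_eq_iff:
  assumes "n \<le> p" "x \<in> topspace (tower S n)" "x' \<in> topspace (tower S n)"
  shows "tower_phi S p n x = tower_phi S p n x' \<longleftrightarrow> x = x'"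
  using assms
proof (induction p rule: dec_induct)
  case (step p)
  then show ?case
    using inj_on_tower_step[OF S, of p] tower_phi_in[of n p]
    by (simp add: tower_phi_Suc inj_on_eq_iff)
qed simp

text \<open>Iterates \<open>tower_step_pi\<close>. With \<open>n = 0\<close> it transports a gluing
  that happens in X_1 to every higher level.\<close>

lemma tower_phi_pi:
  assumes "n \<le> p" "y \<in> topspace (sY S)" "x \<in> topspace (tower S n)"
  shows "tower_phi S (Suc p) (Suc n) (tower_pi S n (y, x)) = tower_pi S p (y, tower_phi S p n x)"
  using assms(1)
proof (induction p rule: dec_induct)
  case (step p)
  then show ?case
    using assms by (simp add: tower_phi_Suc tower_step_pi[OF S] tower_phi_in)
qed simp

lemma topspace_tower_0: "topspace (tower S 0) = P0 ` topspace (sX0 S)"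
  by (simp add: tower.simps)

text \<open>The gluing relation as a case rule. Its condition on \<open>spi\<close> is restated
  through \<open>tower_pi S 0\<close>, so that \<open>tower_phi_pi\<close> can carry it up the
  tower.\<close>

lemma tower_pi_eq_cases:
  assumes "y \<in> topspace (sY S)" "y' \<in> topspace (sY S)"
    and "x \<in> topspace (tower S n)" "x' \<in> topspace (tower S n)"
    and "tower_pi S n (y, x) = tower_pi S n (y', x')"
  obtains "y = y'" "x = x'"
  | z z' where "z \<in> topspace (tower S 0)" "z' \<in> topspace (tower S 0)"
      "x = tower_phi S n 0 z" "x' = tower_phi S n 0 z'" "tower_pi S 0 (y, z) = tower_pi S 0 (y', z')"
proof -
  have "((y, x), (y', x')) \<in> glue_rel S (topspace (tower S n)) (\<lambda>x. tower_phi S n 0 (P0 x))"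
    using assms tower_pi_eq_iff[OF S, of "(y, x)" n "(y', x')"] by auto
  then consider "y = y'" "x = x'" | w w' where "w \<in> topspace (sX0 S)" "w' \<in> topspace (sX0 S)"
      "x = tower_phi S n 0 (P0 w)" "x' = tower_phi S n 0 (P0 w')" "spi S (y, w) = spi S (y', w')"
    unfolding glue_rel_def by blast
  then show thesis
  proof cases
    case 1
    then show ?thesis by (rule that(1))
  next
    case (2 w w')
    then show ?thesis
      using that(2)[of "P0 w" "P0 w'"] by (simp add: topspace_tower_0 tower_pi.simps)
  qed
qed

section \<open>Topology of the tower\<close>

lemma continuous_un_P0: "continuous_map (tower S 0) (sX0 S) un_P0"
proof (rule continuous_compose_quotient_map)
  show "quotient_map (sX0 S) (tower S 0) P0"
    unfolding tower.simps by (rule quotient_map_quotient_topology)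
qed (simp add: o_def)

lemma continuous_P1: "continuous_map (sX1 S) (tower S (Suc 0)) P1"
  unfolding tower.simps by (intro quotient_imp_continuous_map quotient_map_quotient_topology)

lemma continuous_tower_pi: "continuous_map (prod_topology (sY S) (tower S n)) (tower S (Suc n)) (tower_pi S n)"
proof (cases n)
  case 0
  have "continuous_map (prod_topology (sY S) (tower S 0)) (sX1 S) (spi S \<circ> (\<lambda>p. (fst p, un_P0 (snd p))))"
  proof (rule continuous_map_compose)
    show "continuous_map (prod_topology (sY S) (sX0 S)) (sX1 S) (spi S)"
      using S by (simp add: similarity_scheme_def)
    show "continuous_map (prod_topology (sY S) (tower S 0)) (prod_topology (sY S) (sX0 S)) (\<lambda>p. (fst p, un_P0 (snd p)))"
      by (intro continuous_map_pairedI continuous_map_fst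
          continuous_map_compose[OF continuous_map_snd continuous_un_P0, unfolded o_def])
  qed
  from continuous_map_compose[OF this continuous_P1] show ?thesis
    by (simp add: 0 tower_pi.simps o_def case_prod_unfold)
qed (use quotient_map_tower_Suc quotient_imp_continuous_map in blast)

text \<open>\<open>P0\<close> and \<open>P1\<close> are injective, so their kernels are diagonals,
  which are closed in the square of a Hausdorff space.\<close>

lemma tower_base_compact_Hausdorff:
  "compact_space (tower S 0)" "Hausdorff_space (tower S 0)"
  "compact_space (tower S (Suc 0))" "Hausdorff_space (tower S (Suc 0))"
proof -
  have diag: "{(x, x'). x \<in> A \<and> x' \<in> A \<and> x = x'} = (\<lambda>x. (x, x)) ` A" for A :: "'c set"
    by auto
  have X: "compact_space (sX0 S)" "Hausdorff_space (sX0 S)" "compact_space (sX1 S)" "Hausdorff_space (sX1 S)"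
    using S by (auto simp: similarity_scheme_def)
  have "closedin (prod_topology (sX0 S) (sX0 S))
      {(x, x'). x \<in> topspace (sX0 S) \<and> x' \<in> topspace (sX0 S) \<and> P0 x = P0 x'}"
    unfolding point.inject diag using X by (simp add: Hausdorff_space_closedin_diagonal)
  from compact_Hausdorff_quotient_topology[OF X(1,2) this]
  show "compact_space (tower S 0)" "Hausdorff_space (tower S 0)"
    unfolding tower.simps by this+
  have "closedin (prod_topology (sX1 S) (sX1 S))
      {(x, x'). x \<in> topspace (sX1 S) \<and> x' \<in> topspace (sX1 S) \<and> P1 x = P1 x'}"
    unfolding point.inject diag using X by (simp add: Hausdorff_space_closedin_diagonal)
  from compact_Hausdorff_quotient_topology[OF X(3,4) this]
  show "compact_space (tower S (Suc 0))" "Hausdorff_space (tower S (Suc 0))"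
    unfolding tower.simps by this+
qed

text \<open>The kernel of \<open>tower_pi S (Suc n)\<close> is the diagonal together with the image
  under \<open>?f\<close> of \<open>?A\<close>, the kernel of \<open>tower_pi S 0\<close>. That
  image is compact, hence closed, so the quotient lemma gives the next level. Continuity of
  \<open>tower_phi S n 0\<close> belongs to the induction because \<open>?f\<close> is built from
  the map one level up.\<close>

lemma tower_compact_Hausdorff_step_continuous:
  "compact_space (tower S n) \<and> Hausdorff_space (tower S n) \<and>
   compact_space (tower S (Suc n)) \<and> Hausdorff_space (tower S (Suc n)) \<and>
   continuous_map (tower S n) (tower S (Suc n)) (tower_step S n) \<and>
   continuous_map (tower S 0) (tower S n) (tower_phi S n 0)"
proof (induction n)
  case 0
  have "continuous_map (tower S 0) (tower S (Suc 0)) (P1 \<circ> (sphi S \<circ> un_P0))"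
    using S by (intro continuous_map_compose[OF _ continuous_P1] continuous_map_compose[OF continuous_un_P0])
      (simp add: similarity_scheme_def)
  then show ?case
    using tower_base_compact_Hausdorff by (simp add: tower_step.simps o_def)
next
  case (Suc n)
  let ?X = "tower S (Suc n)" and ?P = "prod_topology (sY S) (tower S (Suc n))"
  let ?Z = "prod_topology (prod_topology (sY S) (tower S 0)) (prod_topology (sY S) (tower S 0))"
  let ?A = "{p \<in> topspace ?Z. tower_pi S 0 (fst p) = tower_pi S 0 (snd p)}"
  let ?f = "\<lambda>p. ((fst (fst p), tower_phi S (Suc n) 0 (snd (fst p))), (fst (snd p), tower_phi S (Suc n) 0 (snd (snd p))))"
  have cY: "compact_space (sY S)" "Hausdorff_space (sY S)"
    using S by (auto simp: similarity_scheme_def)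
  have P: "compact_space ?P" "Hausdorff_space ?P" "Hausdorff_space (prod_topology ?P ?P)"
    using Suc cY by (simp_all add: compact_space_prod_topology Hausdorff_space_prod_topology)
  have phi: "continuous_map (tower S 0) ?X (tower_phi S (Suc n) 0)"
    using Suc continuous_map_compose[of "tower S 0" "tower S n" "tower_phi S n 0" ?X "tower_step S n"]
    by (simp add: tower_phi.simps)
  have "closedin ?Z ?A"
    by (intro closedin_continuous_maps_eq[OF tower_base_compact_Hausdorff(4)]
        continuous_map_compose[OF continuous_map_fst continuous_tower_pi, unfolded o_def]
        continuous_map_compose[OF continuous_map_snd continuous_tower_pi, unfolded o_def])
  moreover have "compact_space ?Z"
    using cY tower_base_compact_Hausdorff by (simp add: compact_space_prod_topology)
  ultimately have "compactin ?Z ?A"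
    by (simp add: closedin_compact_space)
  moreover have "continuous_map ?Z (prod_topology ?P ?P) ?f"
    by (intro continuous_map_pairedI continuous_map_compose[OF _ phi, unfolded o_def]
        continuous_map_compose[OF continuous_map_fst continuous_map_fst, unfolded o_def]
        continuous_map_compose[OF continuous_map_snd continuous_map_fst, unfolded o_def]
        continuous_map_compose[OF continuous_map_fst continuous_map_snd, unfolded o_def]
        continuous_map_compose[OF continuous_map_snd continuous_map_snd, unfolded o_def])
  ultimately have "closedin (prod_topology ?P ?P) (?f ` ?A)"
    using P(3) compactin_imp_closedin image_compactin by blast
  then have "closedin (prod_topology ?P ?P) ((\<lambda>x. (x, x)) ` topspace ?P \<union> ?f ` ?A)"
    using P(2) by (intro closedin_Un) (simp_all add: Hausdorff_space_closedin_diagonal)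
  also have "(\<lambda>x. (x, x)) ` topspace ?P \<union> ?f ` ?A =
    {(x, x'). x \<in> topspace ?P \<and> x' \<in> topspace ?P \<and> tower_pi S (Suc n) x = tower_pi S (Suc n) x'}"
    (is "?L = ?R")
  proof
    \<comment> \<open>An equality in X_1 is pushed to X_{n+2} by
      \<open>tower_phi S (Suc (Suc n)) 1\<close>.\<close>
    have glued: "tower_pi S (Suc n) (y, tower_phi S (Suc n) 0 z) = tower_pi S (Suc n) (y', tower_phi S (Suc n) 0 z')"
      if "y \<in> topspace (sY S)" "y' \<in> topspace (sY S)" "z \<in> topspace (tower S 0)" "z' \<in> topspace (tower S 0)"
        "tower_pi S 0 (y, z) = tower_pi S 0 (y', z')" for y y' z z'
      using tower_phi_pi[of 0 "Suc n" y z] tower_phi_pi[of 0 "Suc n" y' z'] that by simp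
    show "?L \<subseteq> ?R"
      by (auto intro: tower_phi_in glued)
    show "?R \<subseteq> ?L"
    proof clarify
      fix y x y' x'
      assume *: "(y, x) \<in> topspace ?P" "(y', x') \<in> topspace ?P" "tower_pi S (Suc n) (y, x) = tower_pi S (Suc n) (y', x')"
        and **: "((y, x), (y', x')) \<notin> ?f ` ?A"
      have mem: "y \<in> topspace (sY S)" "y' \<in> topspace (sY S)" "x \<in> topspace ?X" "x' \<in> topspace ?X"
        using * by auto
      show "((y, x), (y', x')) \<in> (\<lambda>x. (x, x)) ` topspace ?P"
        using mem *(3)
      proof (cases rule: tower_pi_eq_cases)
        case 1
        then show ?thesis using mem by auto
      next
        case (2 z z')
        then have "((y, x), (y', x')) = ?f ((y, z), (y', z'))" "((y, z), (y', z')) \<in> ?A"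
          using mem by auto
        then show ?thesis using ** by blast
      qed
    qed
  qed
  finally have T2: "compact_space (tower S (Suc (Suc n)))" "Hausdorff_space (tower S (Suc (Suc n)))"
    unfolding tower.simps by (fact compact_Hausdorff_quotient_topology[OF P(1,2)])+
  have "continuous_map ?X (tower S (Suc (Suc n))) (tower_step S (Suc n))"
  proof (rule continuous_compose_quotient_map)
    \<comment> \<open>X_1 is given and not constructed as a quotient of Y \<times> X_0; compactness
      of the source and Hausdorffness of the target yield the quotient property for all
      \<open>n\<close> at once.\<close>
    show "quotient_map (prod_topology (sY S) (tower S n)) ?X (tower_pi S n)"
      using Suc cY tower_pi_image[OF S, of n]
      by (intro continuous_imp_quotient_map continuous_tower_pi) (simp_all add: compact_space_prod_topology)
    have "continuous_map (prod_topology (sY S) (tower S n)) (tower S (Suc (Suc n)))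
        (\<lambda>p. tower_pi S (Suc n) (fst p, tower_step S n (snd p)))"
      using Suc by (intro continuous_map_compose[OF _ continuous_tower_pi, unfolded o_def] continuous_map_pairedI
        continuous_map_fst continuous_map_compose[OF continuous_map_snd, unfolded o_def]) auto
    then show "continuous_map (prod_topology (sY S) (tower S n)) (tower S (Suc (Suc n))) (tower_step S (Suc n) \<circ> tower_pi S n)"
      by (rule continuous_map_eq) (auto simp: tower_step_pi[OF S])
  qed
  then show ?case
    using Suc T2 phi by blast
qed

lemma compact_tower: "compact_space (tower S n)"
  and Hausdorff_tower: "Hausdorff_space (tower S n)"
  and continuous_tower_step: "continuous_map (tower S n) (tower S (Suc n)) (tower_step S n)"
  using tower_compact_Hausdorff_step_continuous by blast+

lemma continuous_tower_phi:
  "n \<le> p \<Longrightarrow> continuous_map (tower S n) (tower S p) (tower_phi S p n)"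
proof (induction p rule: dec_induct)
  case (step p)
  then have "tower_phi S (Suc p) n = tower_step S p \<circ> tower_phi S p n"
    by (simp add: tower_phi.simps)
  then show ?case
    using continuous_map_compose[OF step.IH continuous_tower_step] by (simp add: o_def)
qed simp

section \<open>Sequences and cells\<close>

lemma topspace_seq_space: "topspace (seq_space S) = {u. \<forall>i. u i \<in> topspace (sY S)}"
  by (auto simp: seq_space_def PiE_iff)

lemma compact_seq_space: "compact_space (seq_space S)"
  and Hausdorff_seq_space: "Hausdorff_space (seq_space S)"
  using S by (auto simp: seq_space_def similarity_scheme_def compact_space_product_topology Hausdorff_space_product_topology)

lemma continuous_seq_nth: "continuous_map (seq_space S) (sY S) (\<lambda>u. u i)"
  unfolding seq_space_def by (rule continuous_map_product_projection) simp

text \<open>The arbitrary source \<open>Z\<close> lets the sequence and the base point vary jointly,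
  as the closedness of the graph of \<open>Gam\<close> requires.\<close>

lemma continuous_tower_pi_iter:
  assumes "continuous_map Z (seq_space S) f" "continuous_map Z (tower S q) g"
  shows "continuous_map Z (tower S (p + q)) (\<lambda>z. tower_pi_iter S p q (f z) (g z))"
  using assms(2)
proof (induction p arbitrary: q g)
  case (Suc p)
  have "continuous_map Z (tower S (Suc q)) (\<lambda>z. tower_pi S q (f z p, g z))"
    by (intro continuous_map_compose[OF _ continuous_tower_pi, unfolded o_def] continuous_map_pairedI
        Suc.prems continuous_map_compose[OF assms(1) continuous_seq_nth, unfolded o_def])
  from Suc.IH[OF this] show ?case
    by simp
qed simp

text \<open>The defining recursion consumes the last letter, which acts innermost; this form takes
  off the first letter, which acts outermost, and so exposes the shift.\<close>

lemma tower_pi_iter_Suc: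
  "tower_pi_iter S (Suc p) q u x = tower_pi S (p + q) (u 0, tower_pi_iter S p q (\<lambda>i. u (Suc i)) x)"
  by (induction p arbitrary: q x) simp_all

lemma cell_0: "cell S 0 u = topspace (tower S 0)"
  by (simp add: cell_def)

lemma cell_Suc: "cell S (Suc p) u = (\<lambda>c. tower_pi S p (u 0, c)) ` cell S p (\<lambda>i. u (Suc i))"
  unfolding cell_def image_image tower_pi_iter_Suc by simp

lemma cell_subset:
  "\<forall>i. u i \<in> topspace (sY S) \<Longrightarrow> cell S p u \<subseteq> topspace (tower S p)"
proof (induction p arbitrary: u)
  case (Suc p)
  from Suc.IH[of "\<lambda>i. u (Suc i)"] Suc.prems show ?case
    by (auto simp: cell_Suc intro!: tower_pi_in)
qed (simp add: cell_0)

text \<open>Induction on \<open>p\<close> with \<open>z = tower_pi S p (y, b)\<close>. The image of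
  \<open>z\<close> also equals \<open>tower_pi S (Suc p) (u 0, c)\<close> for some \<open>c\<close>
  in a cell of the shifted sequence. If the two pairs agree, the induction hypothesis applies to
  \<open>b\<close>. If they are only glued, \<open>c\<close> comes from a point \<open>w'\<close> of
  X_0, and the hypothesis applies to the image of \<open>w'\<close> in X_p.\<close>

lemma cell_tower_stepD:
  assumes "\<forall>i. u i \<in> topspace (sY S)" "z \<in> topspace (tower S p)" "tower_step S p z \<in> cell S (Suc p) u"
  shows "z \<in> cell S p u"
  using assms
proof (induction p arbitrary: u z)
  case (Suc p)
  let ?v = "\<lambda>i. u (Suc i)"
  have v: "\<forall>i. ?v i \<in> topspace (sY S)" and u0: "u 0 \<in> topspace (sY S)"
    using Suc.prems(1) by auto
  obtain y b where yb: "y \<in> topspace (sY S)" "b \<in> topspace (tower S p)" "z = tower_pi S p (y, b)"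
    using Suc.prems(2) by (rule tower_pi_cases)
  obtain c where c: "c \<in> cell S (Suc p) ?v" "tower_step S (Suc p) z = tower_pi S (Suc p) (u 0, c)"
    using Suc.prems(3) unfolding cell_Suc[of "Suc p" u] by blast
  have cX: "c \<in> topspace (tower S (Suc p))"
    using cell_subset[OF v] c(1) by blast
  have "tower_pi S (Suc p) (y, tower_step S p b) = tower_pi S (Suc p) (u 0, c)"
    using c(2) yb by (simp add: tower_step_pi[OF S])
  with yb(1) u0 tower_step_in[OF yb(2)] cX show ?case
  proof (cases rule: tower_pi_eq_cases)
    case 1
    then have "b \<in> cell S p ?v"
      using Suc.IH[OF v yb(2)] c(1) by simp
    then show ?thesis
      using 1 yb(3) by (auto simp: cell_Suc)
  next
    case (2 w w')
    have "tower_phi S p 0 w' \<in> cell S p ?v"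
      using Suc.IH[OF v tower_phi_in[of 0 p w']] 2 c(1) by (simp add: tower_phi_Suc)
    moreover have "tower_step S p b = tower_step S p (tower_phi S p 0 w)"
      using 2(3) by (simp add: tower_phi_Suc)
    then have "b = tower_phi S p 0 w"
      using inj_on_tower_step[OF S, of p] yb(2) tower_phi_in[of 0 p w] 2(1) by (auto dest: inj_onD)
    \<comment> \<open>The gluing of \<open>(y, w)\<close> with \<open>(u 0, w')\<close> in X_1,
      carried up, provides a second representative of \<open>z\<close> whose first entry is
      \<open>u 0\<close>.\<close>
    then have "z = tower_pi S p (u 0, tower_phi S p 0 w')"
      using tower_phi_pi[of 0 p y w] tower_phi_pi[of 0 p "u 0" w'] 2 yb u0 by simp
    ultimately show ?thesis
      by (auto simp: cell_Suc)
  qed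
qed (simp add: cell_0)

section \<open>The sets \<open>Gam S n x\<close> and the relations R_n\<close>

text \<open>The two sides differ only in the conditions for \<open>n \<le> p < m\<close>, and these
  follow from the one at \<open>m\<close> by descending with \<open>cell_tower_stepD\<close>. Hence
  the R_n increase.\<close>

lemma Gam_tower_phi:
  assumes "n \<le> m" "x \<in> topspace (tower S n)"
  shows "Gam S m (tower_phi S m n x) = Gam S n x"
proof
  show "Gam S n x \<subseteq> Gam S m (tower_phi S m n x)"
    using assms by (auto simp: Gam_def tower_phi_trans)
  show "Gam S m (tower_phi S m n x) \<subseteq> Gam S n x"
  proof
    fix u assume u: "u \<in> Gam S m (tower_phi S m n x)"
    then have uY: "\<forall>i. u i \<in> topspace (sY S)"
      by (auto simp: Gam_def topspace_seq_space)
    have large: "tower_phi S p n x \<in> cell S p u" if "m \<le> p" for p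
      using u that assms by (auto simp: Gam_def tower_phi_trans)
    have "tower_phi S p n x \<in> cell S p u" if "n \<le> p" for p
    proof (cases "m \<le> p")
      case False
      then have "p \<le> m" by simp
      then show ?thesis
        using that
      proof (induction p rule: inc_induct)
        case base
        then show ?case by (simp add: large)
      next
        case (step p)
        then show ?case
          using cell_tower_stepD[OF uY tower_phi_in[OF _ assms(2)], of p] by (simp add: tower_phi_Suc)
      qed
    qed (rule large)
    then show "u \<in> Gam S n x"
      using u by (auto simp: Gam_def)
  qed
qed

text \<open>The relation called R_n in the overview.\<close>

definition level_rel :: "nat \<Rightarrow> ((nat \<Rightarrow> 'y) \<times> (nat \<Rightarrow> 'y)) set" where
  "level_rel n = {(u, v). \<exists>x \<in> topspace (tower S n). u \<in> Gam S n x \<and> v \<in> Gam S n x}"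

lemma level_rel_mono: "n \<le> m \<Longrightarrow> level_rel n \<subseteq> level_rel m"
  unfolding level_rel_def using Gam_tower_phi[of n m] tower_phi_in[of n m] by blast

text \<open>For each \<open>p \<ge> n\<close>, the cell condition is the projection along the
  compact space X_0 of \<open>?E p\<close>, the coincidence set of two continuous maps into the
  Hausdorff space X_p. The graph is the intersection of these closed sets.\<close>

lemma closedin_Gam_graph:
  "closedin (prod_topology (seq_space S) (tower S n))
     {p \<in> topspace (prod_topology (seq_space S) (tower S n)). fst p \<in> Gam S n (snd p)}"
proof -
  let ?P = "prod_topology (seq_space S) (tower S n)"
  let ?E = "\<lambda>p. {r \<in> topspace (prod_topology ?P (tower S 0)).
      tower_phi S p n (snd (fst r)) = tower_pi_iter S p 0 (fst (fst r)) (snd r)}"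
  have "closedin ?P (fst ` ?E p)" if "n \<le> p" for p
  proof -
    have "continuous_map (prod_topology ?P (tower S 0)) (tower S (p + 0))
        (\<lambda>r. tower_pi_iter S p 0 (fst (fst r)) (snd r))"
      by (intro continuous_tower_pi_iter continuous_map_snd
          continuous_map_compose[OF continuous_map_fst continuous_map_fst, unfolded o_def])
    moreover have "continuous_map (prod_topology ?P (tower S 0)) (tower S p)
        (\<lambda>r. tower_phi S p n (snd (fst r)))"
      by (intro continuous_map_compose[OF _ continuous_tower_phi[OF that], unfolded o_def]
          continuous_map_compose[OF continuous_map_fst continuous_map_snd, unfolded o_def])
    ultimately have "closedin (prod_topology ?P (tower S 0)) (?E p)"
      by (intro closedin_continuous_maps_eq[OF Hausdorff_tower]) simp_all
    then show ?thesis
      using Abstract_Topological_Spaces.closed_map_fst[OF compact_tower[of 0], of ?P]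
      by (simp add: closed_map_def)
  qed
  then have "closedin ?P (\<Inter>p\<in>{n..}. fst ` ?E p)"
    by (intro closedin_INT) auto
  also have "(\<Inter>p\<in>{n..}. fst ` ?E p) = {p \<in> topspace ?P. fst p \<in> Gam S n (snd p)}"
  proof -
    have "(u, x) \<in> fst ` ?E p \<longleftrightarrow>
      u \<in> topspace (seq_space S) \<and> x \<in> topspace (tower S n) \<and> tower_phi S p n x \<in> cell S p u" for u x p
      by (force simp: cell_def image_iff)
    then show ?thesis
      by (auto simp: Gam_def)
  qed
  finally show ?thesis .
qed

text \<open>A projection along the compact space X_n of the triples for which both sequences lie in
  \<open>Gam S n x\<close>.\<close>

lemma closedin_level_rel: "closedin (prod_topology (seq_space S) (seq_space S)) (level_rel n)"
proof -
  let ?Q = "prod_topology (seq_space S) (seq_space S)"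
  let ?Z = "prod_topology ?Q (tower S n)" and ?P = "prod_topology (seq_space S) (tower S n)"
  let ?G = "{p \<in> topspace ?P. fst p \<in> Gam S n (snd p)}"
  have "closedin ?Z {r \<in> topspace ?Z. (fst (fst r), snd r) \<in> ?G}"
    by (intro closedin_continuous_map_preimage[OF _ closedin_Gam_graph] continuous_map_pairedI continuous_map_snd
        continuous_map_compose[OF continuous_map_fst continuous_map_fst, unfolded o_def])
  moreover have "closedin ?Z {r \<in> topspace ?Z. (snd (fst r), snd r) \<in> ?G}"
    by (intro closedin_continuous_map_preimage[OF _ closedin_Gam_graph] continuous_map_pairedI continuous_map_snd
        continuous_map_compose[OF continuous_map_fst continuous_map_snd, unfolded o_def])
  ultimately have "closedin ?Z ({r \<in> topspace ?Z. (fst (fst r), snd r) \<in> ?G} \<inter>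
      {r \<in> topspace ?Z. (snd (fst r), snd r) \<in> ?G})" (is "closedin ?Z ?W")
    by (rule closedin_Int)
  then have "closedin ?Q (fst ` ?W)"
    using Abstract_Topological_Spaces.closed_map_fst[OF compact_tower[of n], of ?Q]
    unfolding closed_map_def by blast
  also have "fst ` ?W = level_rel n"
  proof
    show "fst ` ?W \<subseteq> level_rel n"
      by (auto simp: level_rel_def)
    show "level_rel n \<subseteq> fst ` ?W"
    proof
      fix r assume "r \<in> level_rel n"
      then obtain u v x where r: "r = (u, v)" "x \<in> topspace (tower S n)" "u \<in> Gam S n x" "v \<in> Gam S n x"
        by (auto simp: level_rel_def)
      then have "(r, x) \<in> ?W"
        by (auto simp: Gam_def)
      then show "r \<in> fst ` ?W"
        by (rule image_eqI[rotated]) simp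
    qed
  qed
  finally show ?thesis .
qed

section \<open>Self-similarity of the relations R_n\<close>

lemma Gam_tower_piI:
  assumes "\<forall>i. u i \<in> topspace (sY S)" "b \<in> topspace (tower S n)" "(\<lambda>i. u (Suc i)) \<in> Gam S n b"
  shows "u \<in> Gam S (Suc n) (tower_pi S n (u 0, b))"
proof -
  have "tower_phi S p (Suc n) (tower_pi S n (u 0, b)) \<in> cell S p u" if p: "Suc n \<le> p" for p
  proof -
    obtain p' where p': "p = Suc p'" "n \<le> p'"
      using p by (metis Suc_le_D Suc_le_mono)
    then show ?thesis
      using assms by (auto simp: tower_phi_pi cell_Suc Gam_def)
  qed
  then show ?thesis
    using assms by (auto simp: Gam_def topspace_seq_space)
qed

text \<open>Outside the image of X_0 the class of \<open>(y, b)\<close> is a singleton. It remains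
  one at each level \<open>p \<ge> n\<close>, since injectivity of \<open>tower_phi S p n\<close>
  keeps the image of \<open>b\<close> off the image of X_0. So first entry and shift can be read
  off.\<close>

lemma Gam_tower_piD:
  assumes y: "y \<in> topspace (sY S)" and b: "b \<in> topspace (tower S n)"
    and nb: "b \<notin> tower_phi S n 0 ` topspace (tower S 0)"
    and u: "u \<in> Gam S (Suc n) (tower_pi S n (y, b))"
  shows "u 0 = y" "(\<lambda>i. u (Suc i)) \<in> Gam S n b"
proof -
  let ?v = "\<lambda>i. u (Suc i)"
  have uY: "\<forall>i. u i \<in> topspace (sY S)"
    using u by (auto simp: Gam_def topspace_seq_space)
  have *: "u 0 = y \<and> tower_phi S p n b \<in> cell S p ?v" if p: "n \<le> p" for p
  proof -
    have "tower_phi S (Suc p) (Suc n) (tower_pi S n (y, b)) \<in> cell S (Suc p) u"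
      using u p by (auto simp: Gam_def)
    then obtain c where c: "c \<in> cell S p ?v" "tower_pi S p (y, tower_phi S p n b) = tower_pi S p (u 0, c)"
      unfolding cell_Suc tower_phi_pi[OF p y b] by blast
    have "c \<in> topspace (tower S p)"
      using cell_subset[of ?v p] uY c(1) by blast
    from y uY[rule_format, of 0] tower_phi_in[OF p b] this c(2) show ?thesis
    proof (cases rule: tower_pi_eq_cases)
      case 1
      then show ?thesis using c by simp
    next
      case (2 z z')
      then have "tower_phi S p n b = tower_phi S p n (tower_phi S n 0 z)"
        using p by (simp add: tower_phi_trans)
      then have "b = tower_phi S n 0 z"
        using tower_phi_eq_iff[OF p b] 2(1) tower_phi_in[of 0 n z] by simp
      then show ?thesis using nb 2(1) by blast
    qed
  qed
  show "u 0 = y"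
    using *[of n] by simp
  show "?v \<in> Gam S n b"
    using * uY by (auto simp: Gam_def topspace_seq_space)
qed

text \<open>Write the common point as \<open>tower_pi S n (y, b)\<close>. If \<open>b\<close> comes
  from X_0, the point comes from X_1 and \<open>Gam_tower_phi\<close> lowers the pair to level 1;
  otherwise \<open>Gam_tower_piD\<close> applies to both sequences.\<close>

lemma level_rel_SucD:
  assumes "(u, v) \<in> level_rel (Suc n)"
  shows "(u, v) \<in> level_rel 1 \<or> u 0 = v 0 \<and> (\<lambda>i. u (Suc i), \<lambda>i. v (Suc i)) \<in> level_rel n"
proof -
  obtain x where x: "x \<in> topspace (tower S (Suc n))" "u \<in> Gam S (Suc n) x" "v \<in> Gam S (Suc n) x"
    using assms by (auto simp: level_rel_def)
  obtain y b where yb: "y \<in> topspace (sY S)" "b \<in> topspace (tower S n)" "x = tower_pi S n (y, b)"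
    using x(1) by (rule tower_pi_cases)
  show ?thesis
  proof (cases "b \<in> tower_phi S n 0 ` topspace (tower S 0)")
    case True
    then obtain z where z: "z \<in> topspace (tower S 0)" "b = tower_phi S n 0 z"
      by blast
    have "x = tower_phi S (Suc n) (Suc 0) (tower_pi S 0 (y, z))"
      using z yb by (simp add: tower_phi_pi)
    moreover have "tower_pi S 0 (y, z) \<in> topspace (tower S (Suc 0))"
      using yb z by (simp add: tower_pi_in)
    ultimately have "(u, v) \<in> level_rel 1"
      using x Gam_tower_phi[of "Suc 0" "Suc n" "tower_pi S 0 (y, z)"] by (auto simp: level_rel_def)
    then show ?thesis ..
  next
    case False
    then show ?thesis
      using Gam_tower_piD[OF yb(1,2)] x yb by (auto simp: level_rel_def)
  qed
qed

text \<open>The resulting level depends on \<open>k\<close> alone, not on \<open>n\<close>; this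
  uniformity makes the union of the R_n together with the diagonal closed. Outside level 1 the first
  entries agree, the induction hypothesis bounds the level of the shifts, and putting the common
  entry back in front costs one level. Entries count from 0, hence \<open>Suc k\<close>.\<close>

lemma level_rel_bound:
  assumes "(u, v) \<in> level_rel n" "u k \<noteq> v k"
  shows "(u, v) \<in> level_rel (Suc k)"
  using assms
proof (induction k arbitrary: n u v)
  case 0
  show ?case
  proof (cases n)
    case 0
    then show ?thesis
      using "0.prems"(1) level_rel_mono[of 0 "Suc 0"] by auto
  next
    case (Suc m)
    then show ?thesis
      using level_rel_SucD[of u v m] 0 by auto
  qed
next
  case (Suc k)
  let ?u = "\<lambda>i. u (Suc i)" and ?v = "\<lambda>i. v (Suc i)"
  show ?case
  proof (cases "(u, v) \<in> level_rel 1")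
    case True
    then show ?thesis
      using level_rel_mono[of 1 "Suc (Suc k)"] by auto
  next
    case False
    then have "n \<noteq> 0"
      using Suc.prems(1) level_rel_mono[of 0 1] by (auto intro: gr0I)
    then obtain m where "n = Suc m"
      by (cases n) auto
    then have 0: "u 0 = v 0" and "(?u, ?v) \<in> level_rel m"
      using level_rel_SucD[of u v m] Suc.prems(1) False by auto
    then have "(?u, ?v) \<in> level_rel (Suc k)"
      using Suc.IH[of ?u ?v m] Suc.prems(2) by simp
    then obtain b where b: "b \<in> topspace (tower S (Suc k))" "?u \<in> Gam S (Suc k) b" "?v \<in> Gam S (Suc k) b"
      by (auto simp: level_rel_def)
    have uv: "\<forall>i. u i \<in> topspace (sY S)" "\<forall>i. v i \<in> topspace (sY S)"
      using Suc.prems(1) by (auto simp: level_rel_def Gam_def topspace_seq_space)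
    show ?thesis
      using Gam_tower_piI[OF uv(1) b(1,2)] Gam_tower_piI[OF uv(2) b(1,3)] 0
        tower_pi_in[OF uv(1)[rule_format, of 0] b(1)]
      by (auto simp: level_rel_def)
  qed
qed

section \<open>Closedness of the relation\<close>

lemma rel_R_eq: "rel_R S = Id_on (topspace (seq_space S)) \<union> (\<Union>n. level_rel n)"
  by (auto simp: rel_R_def level_rel_def Gam_def)

lemma closedin_rel_R: "closedin (prod_topology (seq_space S) (seq_space S)) (rel_R S)"
proof -
  let ?Q = "prod_topology (seq_space S) (seq_space S)"
  let ?E = "\<lambda>k. {p \<in> topspace ?Q. fst p k = snd p k}"
  have E: "closedin ?Q (?E k)" for k
    using S
    by (intro closedin_continuous_maps_eq[of "sY S"]
        continuous_map_compose[OF continuous_map_fst continuous_seq_nth, unfolded o_def]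
        continuous_map_compose[OF continuous_map_snd continuous_seq_nth, unfolded o_def])
      (simp add: similarity_scheme_def)
  \<comment> \<open>From left to right this is \<open>level_rel_bound\<close>. Conversely, a pair in
    none of the sets \<open>level_rel (Suc k)\<close> has equal entries at every index.\<close>
  have "rel_R S = (\<Inter>k. ?E k \<union> level_rel (Suc k))"
  proof
    show "rel_R S \<subseteq> (\<Inter>k. ?E k \<union> level_rel (Suc k))"
    proof (intro subsetI INT_I)
      fix r k assume r: "r \<in> rel_R S"
      then have "r \<in> topspace ?Q"
        by (auto simp: rel_R_def)
      moreover have "r \<in> level_rel (Suc k)" if "fst r k \<noteq> snd r k"
        using r that level_rel_bound[of "fst r" "snd r"] by (auto simp: rel_R_eq)
      ultimately show "r \<in> ?E k \<union> level_rel (Suc k)"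
        by blast
    qed
    show "(\<Inter>k. ?E k \<union> level_rel (Suc k)) \<subseteq> rel_R S"
    proof clarify
      fix u v assume *: "(u, v) \<in> (\<Inter>k. ?E k \<union> level_rel (Suc k))"
      show "(u, v) \<in> rel_R S"
      proof (cases "\<exists>k. (u, v) \<in> level_rel (Suc k)")
        case True
        then show ?thesis by (auto simp: rel_R_eq)
      next
        case False
        then have "(u, v) \<in> ?E k" for k
          using * by blast
        then have "u = v" "u \<in> topspace (seq_space S)"
          by auto
        then show ?thesis
          by (simp add: rel_R_def)
      qed
    qed
  qed
  moreover have "closedin ?Q (\<Inter>k. ?E k \<union> level_rel (Suc k))"
    by (intro closedin_INT closedin_Un E closedin_level_rel) simp
  ultimately show ?thesis
    by (rule ssubst)
qed

section \<open>Full injectivity and transitivity\<close>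

text \<open>All members of \<open>Gam S n x\<close> are related by \<open>rel_R S\<close> and so
  share one class, and \<open>u\<close> witnesses that there is a member; hence the description in
  \<open>phi_inf\<close> denotes that class.\<close>

lemma phi_inf_eq:
  assumes "u \<in> Gam S n x" "x \<in> topspace (tower S n)"
  shows "phi_inf S n x = pi_inf S u"
proof -
  have "pi_inf S v = pi_inf S u" if "v \<in> Gam S n x" for v
  proof -
    have "(v, u) \<in> rel_R S"
      using that assms by (auto simp: rel_R_eq level_rel_def)
    then have "(v, u) \<in> rel_R_inf S"
      by (auto simp: rel_R_inf_def)
    then show ?thesis
      unfolding pi_inf_def by (rule equiv_class_eq[OF equiv_rel_R_inf])
  qed
  then have "pi_inf S ` Gam S n x = {pi_inf S u}"
    using assms(1) by blast
  then show ?thesis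
    by (simp add: phi_inf_def)
qed

lemma equiv_rel_R:
  assumes "fully_injective S"
  shows "equiv (topspace (seq_space S)) (rel_R S)"
proof (rule equivI)
  show "rel_R S \<subseteq> topspace (seq_space S) \<times> topspace (seq_space S)"
    by (auto simp: rel_R_def)
  show "refl_on (topspace (seq_space S)) (rel_R S)"
    by (auto simp: rel_R_def refl_on_def)
  show "sym (rel_R S)"
    unfolding rel_R_def sym_def by blast
  \<comment> \<open>The middle sequence \<open>v\<close> lies in \<open>Gam S n x\<close> and in
    \<open>Gam S n x'\<close>, so both points have the class of \<open>v\<close> as image under
    \<open>phi_inf S n\<close>; full injectivity then forces \<open>x = x'\<close>.\<close>
  have level: "(u, w) \<in> level_rel n" if uv: "(u, v) \<in> level_rel n" and vw: "(v, w) \<in> level_rel n" for u v w n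
  proof -
    obtain x where x: "x \<in> topspace (tower S n)" "u \<in> Gam S n x" "v \<in> Gam S n x"
      using uv unfolding level_rel_def by blast
    obtain x' where x': "x' \<in> topspace (tower S n)" "v \<in> Gam S n x'" "w \<in> Gam S n x'"
      using vw unfolding level_rel_def by blast
    have "phi_inf S n x = phi_inf S n x'"
      unfolding phi_inf_eq[OF x(3,1)] phi_inf_eq[OF x'(2,1)] ..
    then have "x = x'"
      using assms x(1) x'(1) unfolding fully_injective_def by (blast dest: inj_onD)
    then show ?thesis
      using x x' unfolding level_rel_def by blast
  qed
  show "trans (rel_R S)"
  proof (rule transI)
    fix u v w assume "(u, v) \<in> rel_R S" "(v, w) \<in> rel_R S"
    then consider "u = v \<or> v = w" | n m where "(u, v) \<in> level_rel n" "(v, w) \<in> level_rel m"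
      unfolding rel_R_eq by blast
    then show "(u, w) \<in> rel_R S"
    proof cases
      case 1
      then show ?thesis using \<open>(u, v) \<in> rel_R S\<close> \<open>(v, w) \<in> rel_R S\<close> by auto
    next
      case 2
      \<comment> \<open>Monotonicity lifts both pairs to a common level.\<close>
      then have "(u, w) \<in> level_rel (max n m)"
        using level_rel_mono[of n "max n m"] level_rel_mono[of m "max n m"] by (intro level[of u v _ w]) auto
      then show ?thesis by (auto simp: rel_R_eq)
    qed
  qed
qed

lemma rel_R_inf_eq:
  assumes "fully_injective S"
  shows "rel_R_inf S = rel_R S"
  unfolding rel_R_inf_def using equiv_rel_R[OF assms] by blast

end

theorem theorem4p4:
  fixes S :: "('a, 'b, 'y) scheme"
  assumes "similarity_scheme S"
    and "fully_injective S"
  shows "equiv (topspace (seq_space S)) (rel_R_inf S) \<and>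
         closedin (prod_topology (seq_space S) (seq_space S)) (rel_R_inf S) \<and>
         compact_space (limit_space S) \<and> Hausdorff_space (limit_space S)"
proof -
  have closed: "closedin (prod_topology (seq_space S) (seq_space S)) (rel_R_inf S)"
    unfolding rel_R_inf_eq[OF assms] by (rule closedin_rel_R[OF assms(1)])
  \<comment> \<open>As the kernel of \<open>pi_inf S\<close>, the closed relation has the form that
    the quotient lemma asks for.\<close>
  also have "rel_R_inf S = {(u, v). u \<in> topspace (seq_space S) \<and> v \<in> topspace (seq_space S) \<and>
      pi_inf S u = pi_inf S v}"
    using equiv_class_eq_iff[OF equiv_rel_R_inf[of S]] unfolding pi_inf_def by auto
  finally have "compact_space (limit_space S)" "Hausdorff_space (limit_space S)"
    unfolding limit_space_def
    by (fact compact_Hausdorff_quotient_topology[OF compact_seq_space[OF assms(1)] Hausdorff_seq_space[OF assms(1)]])+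
  with closed equiv_rel_R_inf[of S] show ?thesis
    by simp
qed

end
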